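(* Let $p\ge 0$, $C_A\ge 1$, $\beta\ge 0$, $R>0$, and assume $C_A^{-1}i^{-p}\le\lambda_i\le C_Ai^{-p}$ for $1\le i\le D$. Let $\tau$ be any $\mathcal F$-stopping rule. If there exists $\mu\in H^\beta(R,D)$ with $\mathcal R(\mu,\tau)\le C_\mu\,\mathcal R^*_{\beta,p,R}(\delta)$, then for any $\alpha\in[0,\beta]$ and $\bar R\ge 2R$ there exists $\bar\mu\in H^\alpha(\bar R,D)$ such that $$\mathcal R(\bar\mu,\tau)\ge c_1\,\bar R\,(R^{-1}\delta)^{2\alpha/(2\beta+2p+1)},$$ provided $D\ge c_2\,t_{\beta,p,R}(\delta)$. The constants $c_1,c_2>0$ only depend on $C_\mu$ and $C_A$.
   Context: Model: $D\ge 1$ is an integer, $\delta>0$, $\lambda_1\ge\cdots\ge\lambda_D>0$ are known, and for a signal $\mu\in\mathbb{R}^D$ one observes $Y_i=\lambda_i\mu_i+\delta\varepsilon_i$, $i=1,\ldots,D$, with $\varepsilon_i$ independent $N(0,1)$; $\mathbb{E}_\mu$ is expectation under signal $\mu$. The $\lambda_i$ may change with $D$ and $\delta$, but $p$ and $C_A$ are considered as fixed constants. Truncated SVD estimators: $\widehat\mu^{(m)}_i=\mathbf 1(i\le m)\lambda_i^{-1}Y_i$, $0\le m\le D$. $\|\cdot\|$ is the Euclidean norm. Frequency filtration: $\mathcal F_m=\sigma(Y_1,\ldots,Y_m)$, $0\le m\le D$, with $\mathcal F_0$ trivial. An $\mathcal F$-stopping rule is a stopping time $\tau$ with respect to $(\mathcal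 F_m)_{0\le m\le D}$ with values in $\{0,\ldots,D\}$ (a fixed function of the data, the same for all signals). $\mathcal R(\mu,\tau)=\mathbb{E}_\mu[\|\widehat\mu^{(\tau)}-\mu\|^2]^{1/2}$. Sobolev-type ellipsoids: $H^\beta(R,D)=\{\mu\in\mathbb{R}^D:\sum_{i=1}^D i^{2\beta}\mu_i^2\le R^2\}$. Minimax truncation time: $t_{\beta,p,R}(\delta)=(R^{-1}\delta)^{-2/(2\beta+2p+1)}$. Minimax rate: $\mathcal R^*_{\beta,p,R}(\delta)=R(R^{-1}\delta)^{2\beta/(2\beta+2p+1)}$.
   Formalization: The constant c_1 may also depend on an upper bound for α and an upper bound for δ/R, since no c_1 depending only on C_μ and C_A works for all α and δ/R; c_2 depends only on C_μ and C_A as stated. *)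

theory Defs
  imports "HOL-Probability.Probability"
begin

text \<open>Signals and observations in \<open>\<real>\<^sup>D\<close> are functions on the index set \<open>{1..D}\<close>, extended by
  \<open>undefined\<close> outside of it.\<close>

definition signal_space :: "nat \<Rightarrow> (nat \<Rightarrow> real) set" where
  "signal_space D = {1..D} \<rightarrow>\<^sub>E UNIV"

definition observation_space :: "nat \<Rightarrow> (nat \<Rightarrow> real) measure" where
  "observation_space D = (\<Pi>\<^sub>M i\<in>{1..D}. borel)"

definition noise :: "nat \<Rightarrow> (nat \<Rightarrow> real) measure" where
  "noise D = (\<Pi>\<^sub>M i\<in>{1..D}. density lborel std_normal_density)"

definition observe :: "nat \<Rightarrow> (nat \<Rightarrow> real) \<Rightarrow> real \<Rightarrow> (nat \<Rightarrow> real) \<Rightarrow> (nat \<Rightarrow> real) \<Rightarrow> nat \<Rightarrow> real" where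
  "observe D lam \<delta> \<mu> \<epsilon> = (\<lambda>i\<in>{1..D}. lam i * \<mu> i + \<delta> * \<epsilon> i)"

definition observation_law :: "nat \<Rightarrow> (nat \<Rightarrow> real) \<Rightarrow> real \<Rightarrow> (nat \<Rightarrow> real) \<Rightarrow> (nat \<Rightarrow> real) measure" where
  "observation_law D lam \<delta> \<mu> = distr (noise D) (observation_space D) (observe D lam \<delta> \<mu>)"

definition svd_estimator :: "(nat \<Rightarrow> real) \<Rightarrow> nat \<Rightarrow> (nat \<Rightarrow> real) \<Rightarrow> nat \<Rightarrow> real" where
  "svd_estimator lam m y i = (if i \<le> m then y i / lam i else 0)"

text \<open>The \<open>\<sigma>\<close>-algebra generated by the first \<open>m\<close> coordinates; it is constant from \<open>m = D\<close> on, so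
  that the time index can range over all of \<open>nat\<close>.\<close>

definition frequency_filtration :: "nat \<Rightarrow> nat \<Rightarrow> (nat \<Rightarrow> real) measure" where
  "frequency_filtration D m =
     sigma (space (observation_space D))
       (\<Union>i\<in>{1..min m D}. {(\<lambda>y. y i) -` B \<inter> space (observation_space D) |B. B \<in> sets borel})"

text \<open>A stopping rule is a function of the observation vector alone, hence the same for all signals.\<close>

definition stopping_rule :: "nat \<Rightarrow> ((nat \<Rightarrow> real) \<Rightarrow> nat) \<Rightarrow> bool" where
  "stopping_rule D \<tau> \<longleftrightarrow>
     stopping_time (frequency_filtration D) \<tau> \<and> (\<forall>y\<in>space (observation_space D). \<tau> y \<le> D)"

definition risk :: "nat \<Rightarrow> (nat \<Rightarrow> real) \<Rightarrow> real \<Rightarrow> (nat \<Rightarrow> real) \<Rightarrow> ((nat \<Rightarrow> real) \<Rightarrow> nat) \<Rightarrow> real" where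
  "risk D lam \<delta> \<mu> \<tau> =
     sqrt (\<integral>y. (\<Sum>i=1..D. (svd_estimator lam (\<tau> y) y i - \<mu> i)\<^sup>2) \<partial>observation_law D lam \<delta> \<mu>)"

definition sobolev_ellipsoid :: "real \<Rightarrow> real \<Rightarrow> nat \<Rightarrow> (nat \<Rightarrow> real) set" where
  "sobolev_ellipsoid \<beta> R D =
     {\<mu> \<in> signal_space D. (\<Sum>i=1..D. real i powr (2 * \<beta>) * (\<mu> i)\<^sup>2) \<le> R\<^sup>2}"

definition minimax_time :: "real \<Rightarrow> real \<Rightarrow> real \<Rightarrow> real \<Rightarrow> real" where
  "minimax_time \<beta> p R \<delta> = (\<delta> / R) powr (- 2 / (2 * \<beta> + 2 * p + 1))"

definition minimax_rate :: "real \<Rightarrow> real \<Rightarrow> real \<Rightarrow> real \<Rightarrow> real" where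
  "minimax_rate \<beta> p R \<delta> = R * (\<delta> / R) powr (2 * \<beta> / (2 * \<beta> + 2 * p + 1))"

end

theory Submission
  imports Defs
begin

text \<open>
  A rule that is good for one signal of smoothness \<open>\<beta>\<close> has to stop early, and it cannot notice a
  bump in the signal that sits at a frequency it does not look at.

  In the risk at \<open>\<mu>\<close>, coordinate \<open>i\<close> costs the variance \<open>\<delta>\<^sup>2 / \<lambda>\<^sub>i\<^sup>2\<close> if the rule reaches it and
  the squared bias \<open>\<mu>\<^sub>i\<^sup>2\<close> if not. The event \<open>i \<le> \<tau>\<close> is decided by the first \<open>i - 1\<close> observations,
  so it is independent of the noise in coordinate \<open>i\<close>, and with \<open>P\<^sub>i\<close> for its probability the squared
  risk is \<open>\<Sum>i=1..D. (\<delta>\<^sup>2 / \<lambda>\<^sub>i\<^sup>2) P\<^sub>i + \<mu>\<^sub>i\<^sup>2 (1 - P\<^sub>i)\<close> (lemma \<open>risk_power2_eq\<close>). Two lower bounds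
  follow by discarding terms.

  The variance part forces early stopping. As \<open>P\<^sub>i\<close> decreases in \<open>i\<close>, reaching \<open>m\<close> costs at least
  \<open>P\<^sub>m \<cdot> (\<Sum>i\<le>m. \<delta>\<^sup>2 / \<lambda>\<^sub>i\<^sup>2)\<close>. If \<open>m\<close> is at least \<open>2 c t\<close> with \<open>t\<close> the minimax time, this sum is at least
  \<open>c \<delta>\<^sup>2 t\<^bsup>2 p + 1\<^esup> / C\<^sub>A\<^sup>2\<close>, which is \<open>c / C\<^sub>A\<^sup>2\<close> times the squared minimax rate. A risk of at most
  \<open>C\<^sub>\<mu>\<close> times the minimax rate therefore gives \<open>P\<^sub>m \<le> (C\<^sub>A C\<^sub>\<mu>)\<^sup>2 / c\<close>
  (lemma \<open>continuation_prob_le_if_minimax\<close>), which is at most \<open>1 / 2\<close> for \<open>c\<close> large.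

  The bias part then punishes early stopping at another signal. Replace \<open>\<mu>\<^sub>m\<close> by the spike
  \<open>(R' / 2) m\<^bsup>-\<alpha>\<^esup>\<close>. The new signal lies in the ellipsoid of smoothness \<open>\<alpha>\<close> and radius \<open>R'\<close>, and
  \<open>P\<^sub>m\<close> is the same for both signals, because it only involves the first \<open>m - 1\<close> coordinates. So
  the rule misses the spike with probability at least \<open>1 / 2\<close>, and the squared risk at the new signal
  is at least half the squared spike. The smallest admissible \<open>m\<close> is \<open>2 c t\<close> rounded up. It is a
  coordinate of the signal because \<open>D \<ge> 2 c t\<close>, and it is of order \<open>t\<close> because a bound on \<open>\<delta> / R\<close> keeps
  \<open>t\<close> away from \<open>0\<close>. Hence the spike is of order \<open>R' t\<^bsup>-\<alpha>\<^esup>\<close>, as claimed.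
\<close>

section \<open>Independence in product measures\<close>

text \<open>This is independence of a set \<open>A\<close> from the coordinate \<open>i\<close>, where \<open>A\<close> is only known to be
  closed under changes of that coordinate. Integrating over the coordinate \<open>i\<close> first
  proves it, without writing \<open>A\<close> as a cylinder over the other coordinates.\<close>
lemma integral_PiM_indicator_times_component:
  fixes g :: "'a \<Rightarrow> real"
  assumes M: "\<And>j. prob_space (M j)" and J: "finite J" "i \<in> J"
    and A: "A \<in> sets (PiM J M)"
    and A_inv: "\<And>x y. x \<in> space (PiM J M) \<Longrightarrow> y \<in> space (M i) \<Longrightarrow> x(i := y) \<in> A \<longleftrightarrow> x \<in> A"
    and g: "integrable (M i) g"
  shows "integrable (PiM J M) (\<lambda>x. indicator A x * g (x i))"
    and "(\<integral>x. indicator A x * g (x i) \<partial>PiM J M) = measure (PiM J M) A * (\<integral>y. g y \<partial>M i)"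
proof -
  interpret M: prob_space "M j" for j by (rule M)
  interpret product_prob_space M by unfold_locales
  have comp: "(\<lambda>x. x i) \<in> measurable (PiM J M) (M i)"
    using J by measurable
  have int: "integrable (PiM J M) (\<lambda>x. indicator A x * h (x i))"
    if h: "integrable (M i) h" for h :: "'a \<Rightarrow> real"
  proof -
    have "integrable (distr (PiM J M) (M i) (\<lambda>x. x i)) h"
      using h J(2) by (subst distr_PiM_component) (auto intro: M)
    then have "integrable (PiM J M) (\<lambda>x. h (x i))"
      using h by (subst (asm) integrable_distr_eq[OF comp]) auto
    then show ?thesis
      using integrable_mult_indicator[OF A, of "\<lambda>x. h (x i)"] by simp
  qed
  show "integrable (PiM J M) (\<lambda>x. indicator A x * g (x i))"
    by (rule int[OF g])
  obtain y\<^sub>0 where y0: "y\<^sub>0 \<in> space (M i)"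
    using M.not_empty by blast
  define c where "c = (\<integral>x. indicator A (x(i := y\<^sub>0)) \<partial>PiM (J - {i}) M :: real)"
  (* On the slice over x, the indicator of A is constant, hence equal to its value at y0. The case
     h = 1 identifies the remaining integral c as the probability of A. *)
  have factor: "(\<integral>x. indicator A x * h (x i) \<partial>PiM J M) = c * (\<integral>y. h y \<partial>M i)"
    if h: "integrable (M i) h" for h :: "'a \<Rightarrow> real"
  proof -
    have J_eq: "J = insert i (J - {i})" using J by blast
    have "(\<integral>x. indicator A x * h (x i) \<partial>PiM J M)
        = (\<integral>x. (\<integral>y. indicator A (x(i := y)) * h y \<partial>M i) \<partial>PiM (J - {i}) M)"
      using int[OF h] J J_eq
      by (subst (1) J_eq, subst product_integral_insert) auto
    also have "\<dots> = (\<integral>x. indicator A (x(i := y\<^sub>0)) * (\<integral>y. h y \<partial>M i) \<partial>PiM (J - {i}) M)"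
    proof (rule Bochner_Integration.integral_cong[OF refl])
      fix x assume x: "x \<in> space (PiM (J - {i}) M)"
      then have x0: "x(i := y\<^sub>0) \<in> space (PiM J M)"
        using y0 J by (auto simp: space_PiM PiE_iff extensional_def)
      have "(\<integral>y. indicator A (x(i := y)) * h y \<partial>M i)
          = (\<integral>y. indicator A (x(i := y\<^sub>0)) * h y \<partial>M i)"
        using A_inv[OF x0] by (intro Bochner_Integration.integral_cong) (auto simp: indicator_def)
      then show "(\<integral>y. indicator A (x(i := y)) * h y \<partial>M i)
          = indicator A (x(i := y\<^sub>0)) * (\<integral>y. h y \<partial>M i)"
        by simp
    qed
    also have "\<dots> = c * (\<integral>y. h y \<partial>M i)"
      by (simp add: c_def)
    finally show ?thesis .
  qed
  have "measure (PiM J M) A = c"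
    using factor[of "\<lambda>_. 1"] A by (simp add: M.prob_space sets.Int_space_eq2)
  then show "(\<integral>x. indicator A x * g (x i) \<partial>PiM J M) = measure (PiM J M) A * (\<integral>y. g y \<partial>M i)"
    using factor[OF g] by simp
qed

section \<open>Stopping rules look only at the past\<close>

lemma space_observation_space [simp]: "space (observation_space D) = signal_space D"
  by (simp add: observation_space_def signal_space_def space_PiM)

lemma space_noise: "space (noise D) = signal_space D"
  by (simp add: noise_def signal_space_def space_PiM)

lemma space_frequency_filtration [simp]: "space (frequency_filtration D m) = signal_space D"
  unfolding frequency_filtration_def by (subst space_measure_of) auto

lemma sets_frequency_filtration:
  "sets (frequency_filtration D m) = sigma_sets (signal_space D)
     (\<Union>i\<in>{1..min m D}. {(\<lambda>y. y i) -` B \<inter> signal_space D |B. B \<in> sets (borel :: real measure)})"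
  unfolding frequency_filtration_def by (subst sets_measure_of) auto

lemma sets_frequency_filtration_subset:
  "sets (frequency_filtration D m) \<subseteq> sets (observation_space D)"
  unfolding sets_frequency_filtration space_observation_space[symmetric]
proof (intro sets.sigma_sets_subset subsetI)
  fix A assume "A \<in> (\<Union>i\<in>{1..min m D}. {(\<lambda>y. y i) -` B \<inter> space (observation_space D) |B. B \<in> sets (borel :: real measure)})"
  then obtain i B where i: "i \<in> {1..D}" and B: "B \<in> sets (borel :: real measure)"
    and A: "A = (\<lambda>y. y i) -` B \<inter> space (observation_space D)" by auto
  have "(\<lambda>y. y i) \<in> measurable (observation_space D) borel"
    unfolding observation_space_def using i by (rule measurable_component_singleton)
  then show "A \<in> sets (observation_space D)"
    unfolding A using B by (rule measurable_sets)
qed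

text \<open>The sets that do not separate \<open>y\<close> from \<open>y'\<close> form a \<open>\<sigma>\<close>-algebra. It contains the generators of
  the \<open>m\<close>-th \<open>\<sigma>\<close>-algebra of the filtration as soon as \<open>y\<close> and \<open>y'\<close> agree up to \<open>m\<close>.\<close>
lemma frequency_filtration_determined:
  assumes "B \<in> sets (frequency_filtration D m)"
    and "y \<in> signal_space D" "y' \<in> signal_space D" "\<And>i. i \<in> {1..m} \<Longrightarrow> y i = y' i"
  shows "y \<in> B \<longleftrightarrow> y' \<in> B"
  using assms(1) unfolding sets_frequency_filtration
  by (induction rule: sigma_sets.induct) (use assms(2-4) in auto)

lemma stopping_rule_sets_le:
  assumes "stopping_rule D \<tau>"
  shows "{y \<in> signal_space D. \<tau> y \<le> m} \<in> sets (frequency_filtration D m)"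
  using assms stopping_timeD[of "frequency_filtration D" \<tau> m]
  by (auto simp: stopping_rule_def pred_def)

lemma stopping_rule_continuation_sets:
  assumes "stopping_rule D \<tau>"
  shows "{y \<in> signal_space D. m \<le> \<tau> y} \<in> sets (observation_space D)"
proof (cases m)
  case 0
  then show ?thesis
    using sets.top[of "observation_space D"] by simp
next
  case (Suc k)
  have "{y \<in> signal_space D. m \<le> \<tau> y} = signal_space D - {y \<in> signal_space D. \<tau> y \<le> k}"
    using Suc by auto
  moreover have "{y \<in> signal_space D. \<tau> y \<le> k} \<in> sets (observation_space D)"
    using stopping_rule_sets_le[OF assms] sets_frequency_filtration_subset by blast
  ultimately show ?thesis
    using sets.compl_sets[of _ "observation_space D"] by simp
qed

text \<open>The event \<open>m \<le> \<tau>\<close> is the complement of \<open>\<tau> \<le> m - 1\<close>: whether coordinate \<open>m\<close> is used is decided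
  before it is seen.\<close>
lemma stopping_rule_predictable:
  assumes "stopping_rule D \<tau>" "y \<in> signal_space D" "y' \<in> signal_space D"
    and "\<And>i. i \<in> {1..<m} \<Longrightarrow> y i = y' i"
  shows "m \<le> \<tau> y \<longleftrightarrow> m \<le> \<tau> y'"
proof (cases m)
  case (Suc k)
  have "y \<in> {y \<in> signal_space D. \<tau> y \<le> k} \<longleftrightarrow> y' \<in> {y \<in> signal_space D. \<tau> y \<le> k}"
    using assms(2-4) Suc
    by (intro frequency_filtration_determined[OF stopping_rule_sets_le[OF assms(1)]]) auto
  then show ?thesis using assms(2,3) Suc by auto
qed simp

section \<open>The probability of reaching a frequency\<close>

definition continuation_prob ::
  "nat \<Rightarrow> (nat \<Rightarrow> real) \<Rightarrow> real \<Rightarrow> (nat \<Rightarrow> real) \<Rightarrow> ((nat \<Rightarrow> real) \<Rightarrow> nat) \<Rightarrow> nat \<Rightarrow> real" where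
  "continuation_prob D lam \<delta> \<mu> \<tau> m =
     measure (observation_law D lam \<delta> \<mu>) {y \<in> signal_space D. m \<le> \<tau> y}"

lemma observe_in_signal_space [simp]: "observe D lam \<delta> \<mu> \<epsilon> \<in> signal_space D"
  by (simp add: observe_def signal_space_def)

lemma observe_measurable: "observe D lam \<delta> \<mu> \<in> measurable (noise D) (observation_space D)"
  unfolding observe_def[abs_def] noise_def observation_space_def
  by (rule measurable_restrict) simp

lemma prob_space_noise: "prob_space (noise D)"
  unfolding noise_def by (intro prob_space_PiM prob_space_normal_density) simp

lemma prob_space_observation_law: "prob_space (observation_law D lam \<delta> \<mu>)"
  unfolding observation_law_def
  by (intro prob_space.prob_space_distr prob_space_noise observe_measurable)

lemma continuation_prob_eq_noise:
  assumes "stopping_rule D \<tau>"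
  shows "continuation_prob D lam \<delta> \<mu> \<tau> m =
     measure (noise D) {\<epsilon> \<in> signal_space D. m \<le> \<tau> (observe D lam \<delta> \<mu> \<epsilon>)}"
  unfolding continuation_prob_def observation_law_def
  using measure_distr[OF observe_measurable stopping_rule_continuation_sets[OF assms]]
  by (simp add: vimage_def Int_def space_noise conj_commute)

text \<open>Two signals that agree before \<open>m\<close> give, for the same noise, the same observations before \<open>m\<close>.
  So not only the probabilities but the events themselves, as sets of noise vectors, coincide. This
  makes a rule blind to a change of the signal at \<open>m\<close> until it reaches \<open>m\<close>.\<close>
lemma continuation_prob_cong:
  assumes \<tau>: "stopping_rule D \<tau>" and agree: "\<And>i. i \<in> {1..<m} \<Longrightarrow> \<mu> i = \<mu>' i"
  shows "continuation_prob D lam \<delta> \<mu> \<tau> m = continuation_prob D lam \<delta> \<mu>' \<tau> m"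
proof -
  have "m \<le> \<tau> (observe D lam \<delta> \<mu> \<epsilon>) \<longleftrightarrow> m \<le> \<tau> (observe D lam \<delta> \<mu>' \<epsilon>)" for \<epsilon>
    by (rule stopping_rule_predictable[OF \<tau> observe_in_signal_space observe_in_signal_space])
       (auto simp: observe_def agree)
  then show ?thesis by (simp add: continuation_prob_eq_noise[OF \<tau>])
qed

lemma continuation_prob_nonneg [simp]: "0 \<le> continuation_prob D lam \<delta> \<mu> \<tau> m"
  by (simp add: continuation_prob_def)

lemma continuation_prob_le_1 [simp]: "continuation_prob D lam \<delta> \<mu> \<tau> m \<le> 1"
  unfolding continuation_prob_def by (rule prob_space.prob_le_1[OF prob_space_observation_law])

lemma continuation_prob_antimono:
  assumes "stopping_rule D \<tau>" "i \<le> m"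
  shows "continuation_prob D lam \<delta> \<mu> \<tau> m \<le> continuation_prob D lam \<delta> \<mu> \<tau> i"
proof -
  interpret prob_space "observation_law D lam \<delta> \<mu>" by (rule prob_space_observation_law)
  show ?thesis
    unfolding continuation_prob_def
    using assms stopping_rule_continuation_sets[OF assms(1)]
    by (intro finite_measure_mono) (auto simp: observation_law_def)
qed

section \<open>Bias-variance decomposition of the risk\<close>

lemma std_normal_second_moment:
  defines "N \<equiv> density lborel std_normal_density"
  shows "integrable N (\<lambda>x. x\<^sup>2)" "(\<integral>x. x\<^sup>2 \<partial>N) = 1"
  using std_normal_moment_even[of 1] unfolding N_def
  by (auto simp: integrable_density integral_density has_bochner_integral_iff)

lemma risk_nonneg: "0 \<le> risk D lam \<delta> \<mu> \<tau>"
  by (simp add: risk_def sum_nonneg)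

text \<open>Where the rule reaches coordinate \<open>i\<close>, the error there is \<open>\<delta> \<epsilon>\<^sub>i / \<lambda>\<^sub>i\<close>, and otherwise it is \<open>-\<mu>\<^sub>i\<close>.
  The first case is the event \<open>i \<le> \<tau>\<close>, which does not depend on \<open>\<epsilon>\<^sub>i\<close>, so the expectation of \<open>\<epsilon>\<^sub>i\<^sup>2\<close> on it
  factorizes. The integrability obtained along the way is essential: the Bochner integral in the
  risk would be \<open>0\<close> for a non-integrable loss.\<close>
lemma risk_power2_eq:
  assumes \<tau>: "stopping_rule D \<tau>" and lam: "\<And>i. i \<in> {1..D} \<Longrightarrow> lam i \<noteq> 0"
  shows "(risk D lam \<delta> \<mu> \<tau>)\<^sup>2 =
    (\<Sum>i=1..D. (\<delta> / lam i)\<^sup>2 * continuation_prob D lam \<delta> \<mu> \<tau> i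
       + (\<mu> i)\<^sup>2 * (1 - continuation_prob D lam \<delta> \<mu> \<tau> i))"
proof -
  define N where "N = density lborel std_normal_density"
  interpret noise: prob_space "noise D" by (rule prob_space_noise)
  interpret N: prob_space N unfolding N_def by (rule prob_space_normal_density) simp
  define X where "X = observe D lam \<delta> \<mu>"
  define A where "A i = {\<epsilon> \<in> signal_space D. i \<le> \<tau> (X \<epsilon>)}" for i
  have A_sets: "A i \<in> sets (noise D)" for i
    using measurable_sets[OF observe_measurable stopping_rule_continuation_sets[OF \<tau>], of lam \<delta> \<mu> i]
    by (simp add: A_def X_def vimage_def Int_def space_noise conj_commute)
  have A_prob: "measure (noise D) (A i) = continuation_prob D lam \<delta> \<mu> \<tau> i" for i
    by (simp add: continuation_prob_eq_noise[OF \<tau>] A_def X_def)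
  have A_inv: "\<epsilon>(i := z) \<in> A i \<longleftrightarrow> \<epsilon> \<in> A i" if "\<epsilon> \<in> signal_space D" "i \<in> {1..D}" for \<epsilon> z i
  proof -
    have "i \<le> \<tau> (X (\<epsilon>(i := z))) \<longleftrightarrow> i \<le> \<tau> (X \<epsilon>)"
      unfolding X_def by (rule stopping_rule_predictable[OF \<tau> observe_in_signal_space observe_in_signal_space])
         (auto simp: observe_def)
    then show ?thesis using that by (auto simp: A_def signal_space_def PiE_iff extensional_def)
  qed
  have noise_term: "integrable (noise D) (\<lambda>\<epsilon>. indicator (A i) \<epsilon> * (\<epsilon> i)\<^sup>2)"
      "(\<integral>\<epsilon>. indicator (A i) \<epsilon> * (\<epsilon> i)\<^sup>2 \<partial>noise D) = measure (noise D) (A i)"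
    if i: "i \<in> {1..D}" for i
  proof -
    have noise_N: "noise D = PiM {1..D} (\<lambda>_. N)" by (simp add: noise_def N_def)
    note factor = integral_PiM_indicator_times_component[of "\<lambda>_. N" "{1..D}" i "A i" "\<lambda>x. x\<^sup>2",
        folded noise_N, OF N.prob_space_axioms finite_atLeastAtMost i A_sets]
    show "integrable (noise D) (\<lambda>\<epsilon>. indicator (A i) \<epsilon> * (\<epsilon> i)\<^sup>2)"
      using A_inv[OF _ i] std_normal_second_moment
      by (intro factor(1)) (auto simp: N_def space_noise)
    have "(\<integral>\<epsilon>. indicator (A i) \<epsilon> * (\<epsilon> i)\<^sup>2 \<partial>noise D) = measure (noise D) (A i) * (\<integral>x. x\<^sup>2 \<partial>N)"
      using A_inv[OF _ i] std_normal_second_moment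
      by (intro factor(2)) (auto simp: N_def space_noise)
    then show "(\<integral>\<epsilon>. indicator (A i) \<epsilon> * (\<epsilon> i)\<^sup>2 \<partial>noise D) = measure (noise D) (A i)"
      using std_normal_second_moment by (simp add: N_def)
  qed
  define L where "L y = (\<Sum>i=1..D. (svd_estimator lam (\<tau> y) y i - \<mu> i)\<^sup>2)" for y
  have L_meas: "L \<in> borel_measurable (observation_space D)"
  proof -
    have "(\<lambda>y. if i \<le> \<tau> y then y i / lam i else 0) \<in> borel_measurable (observation_space D)"
      if i: "i \<in> {1..D}" for i
    proof (rule measurable_If)
      show "(\<lambda>y. y i / lam i) \<in> borel_measurable (observation_space D)"
        unfolding observation_space_def
        using measurable_component_singleton[OF i, of "\<lambda>_. borel :: real measure"] by simp
    qed (use stopping_rule_continuation_sets[OF \<tau>] in auto)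
    then show ?thesis
      unfolding L_def[abs_def] svd_estimator_def by (intro borel_measurable_sum) auto
  qed
  have L_eq: "L (X \<epsilon>) = (\<Sum>i=1..D. (\<delta> / lam i)\<^sup>2 * (indicator (A i) \<epsilon> * (\<epsilon> i)\<^sup>2)
      + (\<mu> i)\<^sup>2 * (1 - indicator (A i) \<epsilon>))" if "\<epsilon> \<in> space (noise D)" for \<epsilon>
    unfolding L_def
  proof (rule sum.cong[OF refl])
    fix i assume i: "i \<in> {1..D}"
    have X_i: "X \<epsilon> i = lam i * \<mu> i + \<delta> * \<epsilon> i"
      using i by (simp add: X_def observe_def)
    have "X \<epsilon> i / lam i - \<mu> i = \<delta> / lam i * \<epsilon> i"
      using lam[OF i] unfolding X_i by (simp add: field_simps)
    then show "(svd_estimator lam (\<tau> (X \<epsilon>)) (X \<epsilon>) i - \<mu> i)\<^sup>2 =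
        (\<delta> / lam i)\<^sup>2 * (indicator (A i) \<epsilon> * (\<epsilon> i)\<^sup>2) + (\<mu> i)\<^sup>2 * (1 - indicator (A i) \<epsilon>)"
      using that by (auto simp: svd_estimator_def A_def space_noise power_mult_distrib power_divide)
  qed
  have "(risk D lam \<delta> \<mu> \<tau>)\<^sup>2 = (\<integral>y. L y \<partial>observation_law D lam \<delta> \<mu>)"
    unfolding risk_def L_def[symmetric]
    by (intro real_sqrt_pow2 integral_nonneg) (auto simp: L_def sum_nonneg)
  also have "\<dots> = (\<integral>\<epsilon>. L (X \<epsilon>) \<partial>noise D)"
    unfolding observation_law_def X_def by (rule integral_distr[OF observe_measurable L_meas])
  also have "\<dots> = (\<integral>\<epsilon>. (\<Sum>i=1..D. (\<delta> / lam i)\<^sup>2 * (indicator (A i) \<epsilon> * (\<epsilon> i)\<^sup>2)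
      + (\<mu> i)\<^sup>2 * (1 - indicator (A i) \<epsilon>)) \<partial>noise D)"
    by (rule Bochner_Integration.integral_cong[OF refl L_eq])
  also have "\<dots> = (\<Sum>i=1..D. (\<delta> / lam i)\<^sup>2 * measure (noise D) (A i)
      + (\<mu> i)\<^sup>2 * (1 - measure (noise D) (A i)))"
  proof -
    have ind: "integrable (noise D) (indicator (A i) :: _ \<Rightarrow> real)" for i
      using A_sets by (simp add: noise.emeasure_eq_measure)
    show ?thesis
      using noise_term ind A_sets
      by (subst Bochner_Integration.integral_sum)
         (auto intro!: sum.cong simp: noise.prob_space sets.Int_space_eq2)
  qed
  finally show ?thesis by (simp add: A_prob)
qed

lemma continuation_cost_le_risk:
  assumes \<tau>: "stopping_rule D \<tau>" and lam: "\<And>i. i \<in> {1..D} \<Longrightarrow> lam i \<noteq> 0" and m: "m \<le> D"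
  shows "continuation_prob D lam \<delta> \<mu> \<tau> m * (\<Sum>i=1..m. (\<delta> / lam i)\<^sup>2) \<le> (risk D lam \<delta> \<mu> \<tau>)\<^sup>2"
proof -
  let ?P = "continuation_prob D lam \<delta> \<mu> \<tau>"
  have "?P m * (\<Sum>i=1..m. (\<delta> / lam i)\<^sup>2) = (\<Sum>i=1..m. (\<delta> / lam i)\<^sup>2 * ?P m)"
    by (simp add: sum_distrib_left mult.commute)
  also have "\<dots> \<le> (\<Sum>i=1..m. (\<delta> / lam i)\<^sup>2 * ?P i + (\<mu> i)\<^sup>2 * (1 - ?P i))"
    by (intro sum_mono add_increasing2 mult_left_mono mult_nonneg_nonneg)
       (auto intro: continuation_prob_antimono[OF \<tau>])
  also have "\<dots> \<le> (\<Sum>i=1..D. (\<delta> / lam i)\<^sup>2 * ?P i + (\<mu> i)\<^sup>2 * (1 - ?P i))"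
    using m by (intro sum_mono2) (auto intro!: add_nonneg_nonneg mult_nonneg_nonneg)
  finally show ?thesis by (subst risk_power2_eq[OF \<tau> lam])
qed

lemma stopped_bias_le_risk:
  assumes \<tau>: "stopping_rule D \<tau>" and lam: "\<And>i. i \<in> {1..D} \<Longrightarrow> lam i \<noteq> 0" and m: "m \<in> {1..D}"
  shows "(\<mu> m)\<^sup>2 * (1 - continuation_prob D lam \<delta> \<mu> \<tau> m) \<le> (risk D lam \<delta> \<mu> \<tau>)\<^sup>2"
proof -
  let ?P = "continuation_prob D lam \<delta> \<mu> \<tau>"
  have "(\<mu> m)\<^sup>2 * (1 - ?P m) \<le> (\<delta> / lam m)\<^sup>2 * ?P m + (\<mu> m)\<^sup>2 * (1 - ?P m)"
    by simp
  also have "\<dots> \<le> (\<Sum>i=1..D. (\<delta> / lam i)\<^sup>2 * ?P i + (\<mu> i)\<^sup>2 * (1 - ?P i))"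
    using m by (intro member_le_sum) (auto intro!: add_nonneg_nonneg mult_nonneg_nonneg)
  finally show ?thesis by (subst risk_power2_eq[OF \<tau> lam])
qed

section \<open>The minimax time and the minimax rate\<close>

text \<open>Of the \<open>m\<close> terms, at least \<open>m - x \<ge> x\<close> have index at least \<open>x\<close>. At the price of the
  factor \<open>2\<close> between \<open>x\<close> and \<open>m\<close>, no constant that depends on \<open>q\<close> appears in the bound.\<close>
lemma powr_le_sum_powr:
  fixes x q :: real
  assumes "0 < x" "0 \<le> q" "2 * x \<le> real m"
  shows "x powr (q + 1) \<le> (\<Sum>i=1..m. real i powr q)"
proof -
  define k where "k = nat \<lceil>x\<rceil>"
  have k: "x \<le> real k" "real k < x + 1" "1 \<le> k"
    using assms(1) unfolding k_def by linarith+
  have "x powr (q + 1) = x * x powr q"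
    using assms(1) by (simp add: powr_add)
  also have "\<dots> \<le> real (card {k..m}) * x powr q"
  proof (rule mult_right_mono)
    have "k \<le> Suc m" using k assms by linarith
    then show "x \<le> real (card {k..m})" using k assms by (simp add: of_nat_diff)
  qed simp
  also have "\<dots> = (\<Sum>i=k..m. x powr q)"
    by simp
  also have "\<dots> \<le> (\<Sum>i=k..m. real i powr q)"
    using k assms by (intro sum_mono powr_mono2) auto
  also have "\<dots> \<le> (\<Sum>i=1..m. real i powr q)"
    using k by (intro sum_mono2) auto
  finally show ?thesis .
qed

lemma minimax_time_powr:
  "minimax_time \<beta> p R \<delta> powr (- \<alpha>) = (\<delta> / R) powr (2 * \<alpha> / (2 * \<beta> + 2 * p + 1))"
  by (simp add: minimax_time_def powr_powr mult.commute)

text \<open>At the minimax time the bias bound \<open>R\<^sup>2 t\<^bsup>-2 \<beta>\<^esup>\<close> and the variance order \<open>\<delta>\<^sup>2 t\<^bsup>2 p + 1\<^esup>\<close> balance, and the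
  squared minimax rate is their common value.\<close>
lemma minimax_rate_power2:
  assumes "\<delta> > 0" "R > 0" "\<beta> \<ge> 0" "p \<ge> 0"
  shows "(minimax_rate \<beta> p R \<delta>)\<^sup>2 = \<delta>\<^sup>2 * minimax_time \<beta> p R \<delta> powr (2 * p + 1)"
proof -
  define r where "r = \<delta> / R"
  define s where "s = 2 * \<beta> + 2 * p + 1"
  have r: "r > 0" and s: "s > 0" and \<delta>: "\<delta> = R * r"
    using assms by (auto simp: r_def s_def)
  have "(r powr (2 * \<beta> / s))\<^sup>2 = r powr (2 + - 2 / s * (2 * p + 1))"
    using r s by (simp add: powr_power) (simp add: s_def field_simps)
  also have "\<dots> = r\<^sup>2 * r powr (- 2 / s * (2 * p + 1))"
    unfolding powr_add using r by simp
  finally show ?thesis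
    unfolding minimax_rate_def minimax_time_def r_def[symmetric] s_def[symmetric] powr_powr
    by (simp add: power_mult_distrib \<delta>)
qed

text \<open>The truncation index below is an integer near a multiple of \<open>t\<close>, so it is of order \<open>t\<close> only if \<open>t\<close>
  is bounded away from \<open>0\<close>. The exponent \<open>2 / (2 \<beta> + 2 p + 1)\<close> is at most \<open>2\<close>, hence a bound on \<open>\<delta> / R\<close>
  suffices for this, uniformly in \<open>\<beta>\<close> and \<open>p\<close>.\<close>
lemma minimax_time_lower_bound:
  assumes "\<delta> > 0" "R > 0" "\<beta> \<ge> 0" "p \<ge> 0" "\<delta> / R \<le> \<kappa>"
  shows "1 \<le> (max 1 \<kappa>)\<^sup>2 * minimax_time \<beta> p R \<delta>"
proof -
  define s where "s = 2 / (2 * \<beta> + 2 * p + 1)"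
  have s: "0 \<le> s" "s \<le> 2" using assms by (auto simp: s_def field_simps)
  have "(\<delta> / R) powr s \<le> max 1 \<kappa> powr s"
    using assms s by (intro powr_mono2) auto
  also have "\<dots> \<le> max 1 \<kappa> powr 2"
    using s by (intro powr_mono) auto
  finally have "(\<delta> / R) powr s \<le> (max 1 \<kappa>)\<^sup>2" by simp
  then have "(\<delta> / R) powr s * (\<delta> / R) powr (- s) \<le> (max 1 \<kappa>)\<^sup>2 * (\<delta> / R) powr (- s)"
    by (intro mult_right_mono) auto
  then show ?thesis
    using assms by (simp add: minimax_time_def s_def powr_add[symmetric])
qed

section \<open>Minimax performance forces early stopping\<close>

text \<open>Reaching \<open>m\<close> costs \<open>P\<^sub>m\<close> times the variance accumulated up to \<open>m\<close>, which is at least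
  \<open>\<delta>\<^sup>2 (c t)\<^bsup>2 p + 1\<^esup> / A\<^sup>2\<close>. Because \<open>c \<ge> 1\<close>, the factor \<open>c\<^bsup>2 p + 1\<^esup>\<close> can be lowered to \<open>c\<close>, and the bound on
  \<open>P\<^sub>m\<close> no longer involves \<open>p\<close>.\<close>
lemma continuation_prob_le_if_minimax:
  assumes \<tau>: "stopping_rule D \<tau>"
    and pos: "\<delta> > 0" "R > 0" "\<beta> \<ge> 0" "p \<ge> 0" "A > 0" "c \<ge> 1"
    and lam: "\<And>i. i \<in> {1..D} \<Longrightarrow> 0 < lam i \<and> lam i \<le> A * real i powr (- p)"
    and risk: "risk D lam \<delta> \<mu> \<tau> \<le> C * minimax_rate \<beta> p R \<delta>"
    and m: "2 * c * minimax_time \<beta> p R \<delta> \<le> real m" "m \<le> D"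
  shows "continuation_prob D lam \<delta> \<mu> \<tau> m \<le> (A * C)\<^sup>2 / c"
proof -
  define t where "t = minimax_time \<beta> p R \<delta>"
  define P where "P = continuation_prob D lam \<delta> \<mu> \<tau> m"
  have t: "t > 0" using pos by (simp add: t_def minimax_time_def)
  have "c * t powr (2 * p + 1) \<le> c powr (2 * p + 1) * t powr (2 * p + 1)"
    using powr_mono[of 1 "2 * p + 1" c] pos by (intro mult_right_mono) auto
  also have "\<dots> = (c * t) powr (2 * p + 1)"
    using t pos by (simp add: powr_mult)
  also have "\<dots> \<le> (\<Sum>i=1..m. real i powr (2 * p))"
    using t pos m(1) by (intro powr_le_sum_powr) (auto simp: t_def)
  finally have "(\<delta> / A)\<^sup>2 * (c * t powr (2 * p + 1)) \<le> (\<delta> / A)\<^sup>2 * (\<Sum>i=1..m. real i powr (2 * p))"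
    by (intro mult_left_mono) auto
  also have "\<dots> \<le> (\<Sum>i=1..m. (\<delta> / lam i)\<^sup>2)"
    unfolding sum_distrib_left
  proof (rule sum_mono)
    fix i assume i: "i \<in> {1..m}"
    then have l: "0 < lam i" "lam i \<le> A * real i powr (- p)" using lam[of i] m(2) by auto
    have "(\<delta> / A)\<^sup>2 * real i powr (2 * p) = (\<delta> / (A * real i powr (- p)))\<^sup>2"
      using i by (simp add: power_divide power_mult_distrib powr_minus powr_power mult.commute divide_simps)
    also have "\<dots> \<le> (\<delta> / lam i)\<^sup>2"
      using l pos by (intro power_mono divide_left_mono) auto
    finally show "(\<delta> / A)\<^sup>2 * real i powr (2 * p) \<le> (\<delta> / lam i)\<^sup>2" .
  qed
  finally have "P * ((\<delta> / A)\<^sup>2 * (c * t powr (2 * p + 1))) \<le> P * (\<Sum>i=1..m. (\<delta> / lam i)\<^sup>2)"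
    by (intro mult_left_mono) (auto simp: P_def)
  also have "\<dots> \<le> (risk D lam \<delta> \<mu> \<tau>)\<^sup>2"
    unfolding P_def using lam m(2) by (intro continuation_cost_le_risk[OF \<tau>]) force+
  also have "\<dots> \<le> (C * minimax_rate \<beta> p R \<delta>)\<^sup>2"
    using risk by (intro power_mono risk_nonneg)
  also have "\<dots> = C\<^sup>2 * (\<delta>\<^sup>2 * t powr (2 * p + 1))"
    using pos by (simp add: power_mult_distrib minimax_rate_power2 t_def)
  finally have "(P * c / A\<^sup>2) * (\<delta>\<^sup>2 * t powr (2 * p + 1)) \<le> C\<^sup>2 * (\<delta>\<^sup>2 * t powr (2 * p + 1))"
    by (simp add: power_divide mult_ac)
  then have "P * c / A\<^sup>2 \<le> C\<^sup>2"
    using t pos by (subst (asm) mult_le_cancel_right) auto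
  then show ?thesis
    using pos by (simp add: P_def field_simps power_mult_distrib)
qed

section \<open>A spike that the rule misses\<close>

text \<open>The spike contributes \<open>R'\<^sup>2 / 4\<close> to the Sobolev sum, and the rest of \<open>\<mu>\<close> at most \<open>R\<^sup>2 \<le> R'\<^sup>2 / 4\<close>,
  since weights of index at least \<open>1\<close> only decrease when \<open>\<beta>\<close> is lowered to \<open>\<alpha>\<close>.\<close>
lemma sobolev_ellipsoid_spike:
  assumes \<mu>: "\<mu> \<in> sobolev_ellipsoid \<beta> R D" and \<alpha>: "\<alpha> \<le> \<beta>" and R: "0 \<le> R" "2 * R \<le> R'"
    and m: "m \<in> {1..D}"
  shows "\<mu>(m := R' / 2 * real m powr (- \<alpha>)) \<in> sobolev_ellipsoid \<alpha> R' D"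
proof -
  define \<mu>' where "\<mu>' = \<mu>(m := R' / 2 * real m powr (- \<alpha>))"
  have "\<mu>' \<in> signal_space D"
    using \<mu> m by (auto simp: \<mu>'_def sobolev_ellipsoid_def signal_space_def PiE_iff extensional_def)
  moreover have "(\<Sum>i=1..D. real i powr (2 * \<alpha>) * (\<mu>' i)\<^sup>2) \<le> R'\<^sup>2"
  proof -
    have "(\<Sum>i=1..D. real i powr (2 * \<alpha>) * (\<mu>' i)\<^sup>2)
        = real m powr (2 * \<alpha>) * (\<mu>' m)\<^sup>2 + (\<Sum>i\<in>{1..D} - {m}. real i powr (2 * \<alpha>) * (\<mu>' i)\<^sup>2)"
      using m by (intro sum.remove) auto
    also have "real m powr (2 * \<alpha>) * (\<mu>' m)\<^sup>2 = R'\<^sup>2 / 4"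
      using m by (simp add: \<mu>'_def power_mult_distrib power_divide powr_power
            powr_add[symmetric])
    also have "(\<Sum>i\<in>{1..D} - {m}. real i powr (2 * \<alpha>) * (\<mu>' i)\<^sup>2)
        \<le> (\<Sum>i\<in>{1..D} - {m}. real i powr (2 * \<beta>) * (\<mu> i)\<^sup>2)"
      using \<alpha> by (intro sum_mono) (auto simp: \<mu>'_def intro!: mult_right_mono powr_mono)
    also have "\<dots> \<le> (\<Sum>i=1..D. real i powr (2 * \<beta>) * (\<mu> i)\<^sup>2)"
      by (intro sum_mono2) auto
    also have "\<dots> \<le> R\<^sup>2"
      using \<mu> by (simp add: sobolev_ellipsoid_def)
    also have "\<dots> \<le> (R' / 2)\<^sup>2"
      using R by (intro power_mono) auto
    finally show ?thesis
      by (simp add: power_divide) (smt (verit) zero_le_power2)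
  qed
  ultimately show ?thesis
    by (simp add: sobolev_ellipsoid_def \<mu>'_def)
qed

theorem corollary2p2:
  fixes C\<^sub>\<mu> C\<^sub>A :: real
  assumes "C\<^sub>A \<ge> 1"
  shows "\<exists>c\<^sub>2>0. \<forall>\<alpha>\<^sub>m\<^sub>a\<^sub>x \<kappa>. \<exists>c\<^sub>1>0.
    \<forall>(D::nat) (lam :: nat \<Rightarrow> real) (\<delta>::real) (p::real) (\<beta>::real) (R::real) \<tau>.
      D \<ge> 1 \<and> \<delta> > 0 \<and> antimono_on {1..D} lam \<and> (\<forall>i\<in>{1..D}. lam i > 0) \<and>
      p \<ge> 0 \<and> \<beta> \<ge> 0 \<and> R > 0 \<and>
      (\<forall>i\<in>{1..D}. real i powr (- p) / C\<^sub>A \<le> lam i \<and> lam i \<le> C\<^sub>A * real i powr (- p)) \<and>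
      stopping_rule D \<tau> \<and>
      (\<exists>\<mu>\<in>sobolev_ellipsoid \<beta> R D. risk D lam \<delta> \<mu> \<tau> \<le> C\<^sub>\<mu> * minimax_rate \<beta> p R \<delta>) \<and>
      \<delta> / R \<le> \<kappa> \<longrightarrow>
      (\<forall>\<alpha>\<in>{0..\<beta>}. \<forall>R'\<ge>2 * R.
        \<alpha> \<le> \<alpha>\<^sub>m\<^sub>a\<^sub>x \<and> real D \<ge> c\<^sub>2 * minimax_time \<beta> p R \<delta> \<longrightarrow>
        (\<exists>\<mu>'\<in>sobolev_ellipsoid \<alpha> R' D.
           risk D lam \<delta> \<mu>' \<tau> \<ge> c\<^sub>1 * R' * (\<delta> / R) powr (2 * \<alpha> / (2 * \<beta> + 2 * p + 1))))"
proof -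
  (* c makes the probability of reaching m at most 1/2. For \<delta> / R \<le> \<kappa>, the index m is at most
     K \<kappa> * t: the summand 2 * c of K is the multiple of t that is rounded up, and the other one pays
     for the rounding. *)
  define c where "c = max 1 (2 * (C\<^sub>A * C\<^sub>\<mu>)\<^sup>2)"
  define K where "K \<kappa> = 2 * c + (max 1 \<kappa>)\<^sup>2" for \<kappa> :: real
  have c: "1 \<le> c" "(C\<^sub>A * C\<^sub>\<mu>)\<^sup>2 / c \<le> 1 / 2"
    by (auto simp: c_def field_simps)
  have K: "1 \<le> K \<kappa>" for \<kappa>
    using c(1) by (simp add: K_def add_increasing2)
  have spike: "\<exists>\<mu>'\<in>sobolev_ellipsoid \<alpha> R' D.
      risk D lam \<delta> \<mu>' \<tau> \<ge> (K \<kappa> powr (- \<alpha>\<^sub>m\<^sub>a\<^sub>x) / 4) * R' * (\<delta> / R) powr (2 * \<alpha> / (2 * \<beta> + 2 * p + 1))"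
    if \<delta>: "\<delta> > 0" and lam_pos: "\<And>i. i \<in> {1..D} \<Longrightarrow> lam i > 0"
      and p: "p \<ge> 0" and \<beta>: "\<beta> \<ge> 0" and R: "R > 0"
      and lam: "\<And>i. i \<in> {1..D} \<Longrightarrow> lam i \<le> C\<^sub>A * real i powr (- p)"
      and \<tau>: "stopping_rule D \<tau>"
      and \<mu>: "\<mu> \<in> sobolev_ellipsoid \<beta> R D"
      and risk: "risk D lam \<delta> \<mu> \<tau> \<le> C\<^sub>\<mu> * minimax_rate \<beta> p R \<delta>"
      and \<kappa>: "\<delta> / R \<le> \<kappa>" and \<alpha>: "0 \<le> \<alpha>" "\<alpha> \<le> \<beta>" "\<alpha> \<le> \<alpha>\<^sub>m\<^sub>a\<^sub>x" and R': "2 * R \<le> R'"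
      and D: "2 * c * minimax_time \<beta> p R \<delta> \<le> real D"
    for D lam \<delta> p \<beta> R \<tau> \<mu> \<kappa> \<alpha> \<alpha>\<^sub>m\<^sub>a\<^sub>x R'
  proof -
    define t where "t = minimax_time \<beta> p R \<delta>"
    define m where "m = nat \<lceil>2 * c * t\<rceil>"
    define \<mu>' where "\<mu>' = \<mu>(m := R' / 2 * real m powr (- \<alpha>))"
    have t: "t > 0" using \<delta> R by (simp add: t_def minimax_time_def)
    have ct: "2 * c * t > 0" using t c(1) by simp
    have m: "2 * c * t \<le> real m" "real m < 2 * c * t + 1" "m \<in> {1..D}"
      using ct D unfolding m_def t_def by (auto simp: nat_le_iff ceiling_le_iff) linarith+
    have lam_nz: "\<And>i. i \<in> {1..D} \<Longrightarrow> lam i \<noteq> 0" using lam_pos by force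
    have m_le: "real m \<le> K \<kappa> * t"
      using m(2) minimax_time_lower_bound[OF \<delta> R \<beta> p \<kappa>] by (simp add: K_def t_def algebra_simps)
    have reach: "continuation_prob D lam \<delta> \<mu> \<tau> m \<le> (C\<^sub>A * C\<^sub>\<mu>)\<^sup>2 / c"
      using \<open>C\<^sub>A \<ge> 1\<close> \<delta> R \<beta> p c(1) lam_pos lam risk m
      by (intro continuation_prob_le_if_minimax[OF \<tau>]) (auto simp: t_def)
    have "continuation_prob D lam \<delta> \<mu>' \<tau> m = continuation_prob D lam \<delta> \<mu> \<tau> m"
      by (rule continuation_prob_cong[OF \<tau>]) (simp add: \<mu>'_def)
    then have half: "continuation_prob D lam \<delta> \<mu>' \<tau> m \<le> 1 / 2"
      using order_trans[OF reach c(2)] by simp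
    (* The probability 1/2 of missing the spike is lowered to 1/4, whose square root is rational. *)
    have "(\<mu>' m / 2)\<^sup>2 \<le> (\<mu>' m)\<^sup>2 * (1 / 2)"
      by (simp add: power_divide)
    also have "\<dots> \<le> (\<mu>' m)\<^sup>2 * (1 - continuation_prob D lam \<delta> \<mu>' \<tau> m)"
      using half by (intro mult_left_mono) auto
    also have "\<dots> \<le> (risk D lam \<delta> \<mu>' \<tau>)\<^sup>2"
      by (rule stopped_bias_le_risk[OF \<tau> lam_nz m(3)])
    finally have "\<mu>' m / 2 \<le> risk D lam \<delta> \<mu>' \<tau>"
      by (rule power2_le_imp_le[OF _ risk_nonneg])
    moreover have "K \<kappa> powr (- \<alpha>\<^sub>m\<^sub>a\<^sub>x) / 4 * R' * t powr (- \<alpha>) \<le> \<mu>' m / 2"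
    proof -
      have "K \<kappa> powr (- \<alpha>\<^sub>m\<^sub>a\<^sub>x) * t powr (- \<alpha>) \<le> K \<kappa> powr (- \<alpha>) * t powr (- \<alpha>)"
        using K \<alpha>(3) by (intro mult_right_mono powr_mono) auto
      also have "\<dots> = (K \<kappa> * t) powr (- \<alpha>)"
        using K[of \<kappa>] t by (simp add: powr_mult)
      also have "\<dots> \<le> real m powr (- \<alpha>)"
        using m(3) m_le \<alpha>(1) by (intro powr_mono2') auto
      finally have "R' / 4 * (K \<kappa> powr (- \<alpha>\<^sub>m\<^sub>a\<^sub>x) * t powr (- \<alpha>)) \<le> R' / 4 * real m powr (- \<alpha>)"
        using R R' by (intro mult_left_mono) auto
      then show ?thesis by (simp add: \<mu>'_def mult_ac)
    qed
    ultimately have "K \<kappa> powr (- \<alpha>\<^sub>m\<^sub>a\<^sub>x) / 4 * R' * (\<delta> / R) powr (2 * \<alpha> / (2 * \<beta> + 2 * p + 1))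
        \<le> risk D lam \<delta> \<mu>' \<tau>"
      unfolding t_def minimax_time_powr by linarith
    moreover have "\<mu>' \<in> sobolev_ellipsoid \<alpha> R' D"
      unfolding \<mu>'_def using R by (intro sobolev_ellipsoid_spike[OF \<mu> \<alpha>(2) _ R' m(3)]) simp
    ultimately show ?thesis by blast
  qed
  have c1: "0 < K \<kappa> powr (- \<alpha>\<^sub>m\<^sub>a\<^sub>x) / 4" for \<kappa> \<alpha>\<^sub>m\<^sub>a\<^sub>x
    using K[of \<kappa>] by simp
  have c2: "0 < 2 * c"
    using c(1) by simp
  show ?thesis
    apply (rule exI[of _ "2 * c"], rule conjI[OF c2], intro allI)
    subgoal for \<alpha>\<^sub>m\<^sub>a\<^sub>x \<kappa>
      apply (rule exI[of _ "K \<kappa> powr (- \<alpha>\<^sub>m\<^sub>a\<^sub>x) / 4"], rule conjI[OF c1])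
      apply (intro allI impI ballI, elim conjE bexE)
      apply (rule spike; (assumption | simp))
      done
    done
qed

end
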